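(* Let $D$ be a set, let $X$ be a real linear space and let $f\colon D\to X$ be an admissible function. Then $\mathscr{B}_f\colon\mathscr{W}(D)\to D$ is a decision-making function on $D$ and $\beta_f\colon\mathscr{W}(D)\to\mathbb{R}_+$ is an effort function on $D$.
   Context: Notation: $\mathbb{R}_+=(0,+\infty)$; $W_n=[0,+\infty)^n\setminus\{(0,\dots,0)\}$; $\mathscr{W}(D)=\bigcup_{n=1}^\infty D^n\times W_n$. Admissible functions and generalized Bajraktarević means: For a nonzero $x$ in a real linear space $X$, the ray generated by $x$ is $R_x=\{\lambda x\mid\lambda\in\mathbb{R}_+\}$; if $y\in R_x$, then $[y:x]$ denotes the unique positive number $\lambda$ with $y=\lambda x$. For $S\subseteq X$, $\operatorname{cone}(S)=\{\lambda x\mid \lambda\in\mathbb{R}_+,\ x\in S\}$. The set $S$ is observable if the rays generated by any two distinct elements of $S$ are disjoint, and conically convex if $\operatorname{cone}(S)$ is convex and $0\notin\operatorname{conv}(S)$. A function $f\colon D\to X$ is admissible if it is injective and $f(D)$ is observable and conically convex. For such $f$, $\pi_f\colon\operatorname{cone}(f(D))\to f(D)$ maps $y$ to the unique point $x\in f(D)$ with $y\in R_x$, and $f^{(-1)}:=f^{-1}\circ\pi_f\colon\operatorname{cone}(f(D))\to D$. For $(x,\lambda)\in D^n\times W_n$ put $\mathscr{B}_f(x,\lambda)=f^{(-1)}\big(\sum_{k=1}^n\lambda_kf(x_k)\big)$ and $\beta_f(x,\lambda)=\big[\sum_{k=1}^n\lambda_kf(x_k):f(\mathscr{B}_f(x,\lambda))\big]$.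 Decision-making function: a map $\mathscr{M}\colon\mathscr{W}(D)\to D$ that is (i) reflexive: $\mathscr{M}(x,\lambda)=x$ for all $x\in D$, $\lambda\in\mathbb{R}_+$; (ii) nullhomogeneous in the weights: $\mathscr{M}(x,t\lambda)=\mathscr{M}(x,\lambda)$ for all $(x,\lambda)\in\mathscr{W}(D)$, $t\in\mathbb{R}_+$; (iii) symmetric: for all $n$, $(x,\lambda)\in D^n\times W_n$ and permutations $\sigma$ of $\{1,\dots,n\}$, $\mathscr{M}((x_{\sigma(1)},\dots,x_{\sigma(n)}),(\lambda_{\sigma(1)},\dots,\lambda_{\sigma(n)}))=\mathscr{M}(x,\lambda)$; (iv) eliminative: for $n\ge2$ and $(x,\lambda)\in D^n\times W_n$ with $\lambda_1=0$, $\mathscr{M}(x,\lambda)=\mathscr{M}((x_2,\dots,x_n),(\lambda_2,\dots,\lambda_n))$; (v) reductive: for $n\ge2$ and $(x,\lambda)\in D^n\times W_n$ with $x_1=x_2$, $\mathscr{M}(x,\lambda)=\mathscr{M}((x_2,x_3,\dots,x_n),(\lambda_1+\lambda_2,\lambda_3,\dots,\lambda_n))$. Effort function: a map $\mathscr{E}\colon\mathscr{W}(D)\to\mathbb{R}_+$ that is (i) reflexive in the weights: $\mathscr{E}(x,\lambda)=\lambda$ for all $x\in D$, $\lambda\in\mathbb{R}_+$; (ii) homogeneous in the weights: $\mathscr{E}(x,t\lambda)=t\,\mathscr{E}(x,\lambda)$ for all $(x,\lambda)\in\mathscr{W}(D)$, $t\in\mathbb{R}_+$; and (iii) symmetric,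 (iv) eliminative and (v) reductive, in the same sense as (iii)-(v) above with $\mathscr{E}$ in place of $\mathscr{M}$. *)

theory Defs
  imports "HOL-Analysis.Convex" "HOL-Combinatorics.Permutations"
begin

text \<open>Elements of \<open>D\<^sup>n\<close> and weight vectors are lists of length \<open>n\<close>, so that all \<open>n\<close> live in one type.
  List positions are counted from 0.\<close>

definition weight_vectors :: "nat \<Rightarrow> real list set" where
  "weight_vectors n = {ls. length ls = n \<and> (\<forall>l\<in>set ls. 0 \<le> l)} - {replicate n 0}"

definition weighted_tuples :: "'d set \<Rightarrow> ('d list \<times> real list) set" where
  "weighted_tuples D = (\<Union>n\<in>{1..}. {xs \<in> lists D. length xs = n} \<times> weight_vectors n)"

definition ray :: "'x::real_vector \<Rightarrow> 'x set" where
  "ray x = {c *\<^sub>R x | c. 0 < c}"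

text \<open>\<open>ray_ratio y x\<close> is the number \<open>[y : x]\<close>; it is only meaningful if \<open>x \<noteq> 0\<close> and \<open>y \<in> ray x\<close>.\<close>

definition ray_ratio :: "'x::real_vector \<Rightarrow> 'x \<Rightarrow> real" where
  "ray_ratio y x = (THE c. 0 < c \<and> y = c *\<^sub>R x)"

text \<open>Only strictly positive multiples are taken, unlike in the library notions \<^const>\<open>cone\<close>
  and \<^const>\<open>conic\<close>.\<close>

definition cone_of :: "'x::real_vector set \<Rightarrow> 'x set" where
  "cone_of S = {c *\<^sub>R x | c x. 0 < c \<and> x \<in> S}"

definition observable :: "'x::real_vector set \<Rightarrow> bool" where
  "observable S \<longleftrightarrow> (\<forall>x\<in>S. \<forall>y\<in>S. x \<noteq> y \<longrightarrow> ray x \<inter> ray y = {})"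

definition conically_convex :: "'x::real_vector set \<Rightarrow> bool" where
  "conically_convex S \<longleftrightarrow> convex (cone_of S) \<and> 0 \<notin> convex hull S"

definition admissible :: "'d set \<Rightarrow> ('d \<Rightarrow> 'x::real_vector) \<Rightarrow> bool" where
  "admissible D f \<longleftrightarrow> inj_on f D \<and> observable (f ` D) \<and> conically_convex (f ` D)"

text \<open>The next two functions are only meaningful for arguments in \<open>cone_of (f ` D)\<close>.\<close>

definition ray_projection :: "'d set \<Rightarrow> ('d \<Rightarrow> 'x::real_vector) \<Rightarrow> 'x \<Rightarrow> 'x" where
  "ray_projection D f y = (THE x. x \<in> f ` D \<and> y \<in> ray x)"

definition radial_inverse :: "'d set \<Rightarrow> ('d \<Rightarrow> 'x::real_vector) \<Rightarrow> 'x \<Rightarrow> 'd" where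
  "radial_inverse D f = the_inv_into D f \<circ> ray_projection D f"

definition weighted_sum :: "('d \<Rightarrow> 'x::real_vector) \<Rightarrow> 'd list \<times> real list \<Rightarrow> 'x" where
  "weighted_sum f = (\<lambda>(xs, ls). \<Sum>k<length xs. (ls ! k) *\<^sub>R f (xs ! k))"

definition bajraktarevic_mean ::
    "'d set \<Rightarrow> ('d \<Rightarrow> 'x::real_vector) \<Rightarrow> 'd list \<times> real list \<Rightarrow> 'd" where
  "bajraktarevic_mean D f p = radial_inverse D f (weighted_sum f p)"

definition bajraktarevic_effort ::
    "'d set \<Rightarrow> ('d \<Rightarrow> 'x::real_vector) \<Rightarrow> 'd list \<times> real list \<Rightarrow> real" where
  "bajraktarevic_effort D f p = ray_ratio (weighted_sum f p) (f (bajraktarevic_mean D f p))"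

definition symmetric_on :: "'d set \<Rightarrow> ('d list \<times> real list \<Rightarrow> 'a) \<Rightarrow> bool" where
  "symmetric_on D M \<longleftrightarrow> (\<forall>(xs, ls) \<in> weighted_tuples D. \<forall>\<sigma>.
     \<sigma> permutes {..<length xs} \<longrightarrow> M (permute_list \<sigma> xs, permute_list \<sigma> ls) = M (xs, ls))"

definition eliminative_on :: "'d set \<Rightarrow> ('d list \<times> real list \<Rightarrow> 'a) \<Rightarrow> bool" where
  "eliminative_on D M \<longleftrightarrow> (\<forall>(xs, ls) \<in> weighted_tuples D.
     2 \<le> length xs \<and> ls ! 0 = 0 \<longrightarrow> M (xs, ls) = M (tl xs, tl ls))"

definition reductive_on :: "'d set \<Rightarrow> ('d list \<times> real list \<Rightarrow> 'a) \<Rightarrow> bool" where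
  "reductive_on D M \<longleftrightarrow> (\<forall>(xs, ls) \<in> weighted_tuples D.
     2 \<le> length xs \<and> xs ! 0 = xs ! 1 \<longrightarrow>
       M (xs, ls) = M (tl xs, (ls ! 0 + ls ! 1) # drop 2 ls))"

definition decision_making_function :: "'d set \<Rightarrow> ('d list \<times> real list \<Rightarrow> 'd) \<Rightarrow> bool" where
  "decision_making_function D M \<longleftrightarrow>
     M ` weighted_tuples D \<subseteq> D \<and>
     (\<forall>x\<in>D. \<forall>l>0. M ([x], [l]) = x) \<and>
     (\<forall>(xs, ls) \<in> weighted_tuples D. \<forall>t>0. M (xs, map ((*) t) ls) = M (xs, ls)) \<and>
     symmetric_on D M \<and> eliminative_on D M \<and> reductive_on D M"

definition effort_function :: "'d set \<Rightarrow> ('d list \<times> real list \<Rightarrow> real) \<Rightarrow> bool" where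
  "effort_function D E \<longleftrightarrow>
     E ` weighted_tuples D \<subseteq> {0<..} \<and>
     (\<forall>x\<in>D. \<forall>l>0. E ([x], [l]) = l) \<and>
     (\<forall>(xs, ls) \<in> weighted_tuples D. \<forall>t>0. E (xs, map ((*) t) ls) = t * E (xs, ls)) \<and>
     symmetric_on D E \<and> eliminative_on D E \<and> reductive_on D E"

end

theory Submission
  imports Defs
begin

text \<open>
  Both maps factor through the vector \<open>\<Sum>\<^sub>k \<lambda>\<^sub>k f(x\<^sub>k)\<close>: the mean is \<open>radial_inverse D f\<close> of it, and the
  effort is another function of that vector alone. Permuting the indices, dropping a zero weight,
  and merging the weights of two equal points leave the vector unchanged, so the last three axioms
  hold for any function of it.

  Admissibility enters through polar coordinates: every \<open>y\<close> in \<open>cone_of (f ` D)\<close> is \<open>c f(x)\<close> for a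
  unique point \<open>x \<in> D\<close> and a unique \<open>c > 0\<close>, and these coordinates are exactly the mean and the
  effort (\<open>radial_inverse_scaleR\<close>, \<open>ray_ratio_scaleR\<close>). Observability and injectivity give the
  uniqueness of \<open>x\<close>, and \<open>0 \<notin> conv (f(D))\<close> gives that of \<open>c\<close>. As the cone is convex, it is closed
  under addition, so every nontrivial nonnegative combination of values of \<open>f\<close> lies in it
  (\<open>weighted_sum_in_cone\<close>). Reflexivity reads off the coordinates of \<open>l f(x)\<close>, and the
  homogeneity axioms say that multiplying \<open>y\<close> by \<open>t > 0\<close> keeps \<open>x\<close> and multiplies \<open>c\<close> by \<open>t\<close>.
\<close>

section \<open>Sums of values with weights\<close>

lemma weighted_sum_Nil [simp]: "weighted_sum f ([], ls) = 0"
  by (simp add: weighted_sum_def)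

lemma weighted_sum_Cons [simp]:
  "weighted_sum f (x # xs, l # ls) = l *\<^sub>R f x + weighted_sum f (xs, ls)"
  by (simp add: weighted_sum_def sum.lessThan_Suc_shift del: sum.lessThan_Suc)

lemma weighted_sum_scale:
  assumes "length xs = length ls"
  shows "weighted_sum f (xs, map ((*) t) ls) = t *\<^sub>R weighted_sum f (xs, ls)"
  using assms by (induction xs ls rule: list_induct2) (simp_all add: scaleR_add_right)

lemma weighted_sum_permute:
  assumes "length xs = length ls" "\<sigma> permutes {..<length xs}"
  shows "weighted_sum f (permute_list \<sigma> xs, permute_list \<sigma> ls) = weighted_sum f (xs, ls)"
proof -
  have "weighted_sum f (permute_list \<sigma> xs, permute_list \<sigma> ls)
      = (\<Sum>k<length xs. (ls ! \<sigma> k) *\<^sub>R f (xs ! \<sigma> k))"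
    using assms by (simp add: weighted_sum_def permute_list_nth)
  also have "\<dots> = weighted_sum f (xs, ls)"
    using sum.permute[OF assms(2), of "\<lambda>k. (ls ! k) *\<^sub>R f (xs ! k)"]
    by (simp add: weighted_sum_def comp_def)
  finally show ?thesis .
qed

lemma weighted_tuplesE:
  assumes "(xs, ls) \<in> weighted_tuples D"
  obtains "length xs = length ls" "set xs \<subseteq> D" "\<And>l. l \<in> set ls \<Longrightarrow> 0 \<le> l" "\<exists>l\<in>set ls. l \<noteq> 0"
proof
  show "length xs = length ls" "set xs \<subseteq> D" "\<And>l. l \<in> set ls \<Longrightarrow> 0 \<le> l"
    using assms by (auto simp: weighted_tuples_def weight_vectors_def)
  show "\<exists>l\<in>set ls. l \<noteq> 0"
  proof (rule ccontr)
    assume "\<not> ?thesis"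
    then have "ls = replicate (length ls) 0"
      by (simp add: replicate_length_same)
    with assms show False
      by (auto simp: weighted_tuples_def weight_vectors_def)
  qed
qed

lemma symmetric_on_weighted_sum: "symmetric_on D (\<lambda>p. g (weighted_sum f p))"
  unfolding symmetric_on_def by (auto elim!: weighted_tuplesE simp: weighted_sum_permute)

lemma eliminative_on_weighted_sum: "eliminative_on D (\<lambda>p. g (weighted_sum f p))"
proof -
  have "weighted_sum f (xs, ls) = weighted_sum f (tl xs, tl ls)"
    if "length xs = length ls" "ls ! 0 = 0" for xs ls
    using that by (cases xs; cases ls) auto
  then show ?thesis
    unfolding eliminative_on_def by (auto elim!: weighted_tuplesE)
qed

lemma reductive_on_weighted_sum: "reductive_on D (\<lambda>p. g (weighted_sum f p))"
proof -
  have "weighted_sum f (xs, ls) = weighted_sum f (tl xs, (ls ! 0 + ls ! 1) # drop 2 ls)"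
    if len: "length xs = length ls" "2 \<le> length xs" and eq: "xs ! 0 = xs ! 1" for xs ls
  proof -
    obtain x y xs' where "xs = x # y # xs'"
      using len(2) by (auto simp: numeral_2_eq_2 Suc_le_length_iff)
    moreover obtain l m ls' where "ls = l # m # ls'"
      using len(2) unfolding len(1) by (auto simp: numeral_2_eq_2 Suc_le_length_iff)
    ultimately show ?thesis
      using eq by (simp add: scaleR_add_left)
  qed
  then show ?thesis
    unfolding reductive_on_def by (auto elim!: weighted_tuplesE)
qed

section \<open>Open cones\<close>

lemma scaleR_in_cone: "0 < c \<Longrightarrow> y \<in> cone_of S \<Longrightarrow> c *\<^sub>R y \<in> cone_of S"
  unfolding cone_of_def by clarsimp (metis mult_pos_pos)

text \<open>A sum is twice the midpoint of its summands.\<close>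

lemma convex_cone_add:
  assumes "convex (cone_of S)" "y \<in> cone_of S" "z \<in> cone_of S"
  shows "y + z \<in> cone_of S"
proof -
  have "(1/2) *\<^sub>R y + (1/2) *\<^sub>R z \<in> cone_of S"
    by (rule convexD[OF assms]) auto
  from scaleR_in_cone[of 2, OF _ this] show ?thesis
    by (simp add: scaleR_add_right)
qed

text \<open>The cone need not contain 0, so in the induction a tail whose weights all vanish has to be
  treated apart from one whose sum lies in the cone.\<close>

lemma weighted_sum_in_cone:
  assumes "convex (cone_of (f ` D))" "(xs, ls) \<in> weighted_tuples D"
  shows "weighted_sum f (xs, ls) \<in> cone_of (f ` D)"
proof -
  have "if \<exists>l\<in>set ls. l \<noteq> 0 then weighted_sum f (xs, ls) \<in> cone_of (f ` D)
        else weighted_sum f (xs, ls) = 0"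
    if "length xs = length ls" "set xs \<subseteq> D" "\<forall>l\<in>set ls. 0 \<le> l"
    using that
  proof (induction xs ls rule: list_induct2)
    case (Cons x xs l ls)
    show ?case
    proof (cases "l = 0")
      case False
      with Cons have "l *\<^sub>R f x \<in> cone_of (f ` D)"
        by (fastforce simp: cone_of_def)
      with Cons False convex_cone_add[OF assms(1) this] show ?thesis
        by (auto split: if_splits)
    qed (use Cons in auto)
  qed simp
  with assms(2) show ?thesis
    by (metis weighted_tuplesE)
qed

section \<open>Polar coordinates of an admissible function\<close>

lemma admissible_nonzero: "admissible D f \<Longrightarrow> x \<in> D \<Longrightarrow> f x \<noteq> 0"
  unfolding admissible_def conically_convex_def by (metis hull_inc imageI)

lemma radial_inverse_scaleR:
  assumes "admissible D f" "x \<in> D" "0 < c"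
  shows "radial_inverse D f (c *\<^sub>R f x) = x"
proof -
  have "ray_projection D f (c *\<^sub>R f x) = f x"
    unfolding ray_projection_def
  proof (rule the_equality)
    show "f x \<in> f ` D \<and> c *\<^sub>R f x \<in> ray (f x)"
      using assms by (auto simp: ray_def)
    show "z = f x" if "z \<in> f ` D \<and> c *\<^sub>R f x \<in> ray z" for z
      using that assms \<open>f x \<in> f ` D \<and> c *\<^sub>R f x \<in> ray (f x)\<close>
      unfolding admissible_def observable_def by blast
  qed
  with assms show ?thesis
    by (simp add: radial_inverse_def admissible_def the_inv_into_f_f)
qed

lemma ray_ratio_scaleR: "x \<noteq> 0 \<Longrightarrow> 0 < c \<Longrightarrow> ray_ratio (c *\<^sub>R x) x = c"
  unfolding ray_ratio_def by (rule the_equality) auto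

lemma mean_effort_eqI:
  assumes "admissible D f" "x \<in> D" "0 < c" "weighted_sum f p = c *\<^sub>R f x"
  shows "bajraktarevic_mean D f p = x" "bajraktarevic_effort D f p = c"
  using assms
  by (simp_all add: bajraktarevic_mean_def bajraktarevic_effort_def radial_inverse_scaleR
      ray_ratio_scaleR admissible_nonzero)

lemma mean_effort_polar:
  assumes "admissible D f" "(xs, ls) \<in> weighted_tuples D"
  shows "bajraktarevic_mean D f (xs, ls) \<in> D" "0 < bajraktarevic_effort D f (xs, ls)"
    and "weighted_sum f (xs, ls) =
      bajraktarevic_effort D f (xs, ls) *\<^sub>R f (bajraktarevic_mean D f (xs, ls))"
proof -
  have "weighted_sum f (xs, ls) \<in> cone_of (f ` D)"
    using assms by (intro weighted_sum_in_cone) (auto simp: admissible_def conically_convex_def)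
  then obtain c x where "x \<in> D" "0 < c" "weighted_sum f (xs, ls) = c *\<^sub>R f x"
    by (auto simp: cone_of_def)
  with mean_effort_eqI[OF assms(1) this]
  show "bajraktarevic_mean D f (xs, ls) \<in> D" "0 < bajraktarevic_effort D f (xs, ls)"
    "weighted_sum f (xs, ls) =
      bajraktarevic_effort D f (xs, ls) *\<^sub>R f (bajraktarevic_mean D f (xs, ls))"
    by simp_all
qed

lemma mean_effort_singleton:
  assumes "admissible D f" "x \<in> D" "0 < l"
  shows "bajraktarevic_mean D f ([x], [l]) = x" "bajraktarevic_effort D f ([x], [l]) = l"
  using mean_effort_eqI[OF assms] by simp_all

lemma mean_effort_scale:
  assumes "admissible D f" "(xs, ls) \<in> weighted_tuples D" "0 < t"
  shows "bajraktarevic_mean D f (xs, map ((*) t) ls) = bajraktarevic_mean D f (xs, ls)"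
    and "bajraktarevic_effort D f (xs, map ((*) t) ls) = t * bajraktarevic_effort D f (xs, ls)"
proof -
  note polar = mean_effort_polar[OF assms(1,2)]
  have "length xs = length ls"
    using assms(2) by (rule weighted_tuplesE)
  then have "weighted_sum f (xs, map ((*) t) ls) =
      (t * bajraktarevic_effort D f (xs, ls)) *\<^sub>R f (bajraktarevic_mean D f (xs, ls))"
    by (simp add: weighted_sum_scale flip: polar(3) scaleR_scaleR)
  from mean_effort_eqI[OF assms(1) polar(1) _ this] polar(2) assms(3)
  show "bajraktarevic_mean D f (xs, map ((*) t) ls) = bajraktarevic_mean D f (xs, ls)"
    "bajraktarevic_effort D f (xs, map ((*) t) ls) = t * bajraktarevic_effort D f (xs, ls)"
    by simp_all
qed

theorem theorem3p2:
  fixes D :: "'d set" and f :: "'d \<Rightarrow> 'x::real_vector"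
  assumes "admissible D f"
  shows "decision_making_function D (bajraktarevic_mean D f) \<and>
         effort_function D (bajraktarevic_effort D f)"
proof
  have mean: "bajraktarevic_mean D f = (\<lambda>p. radial_inverse D f (weighted_sum f p))"
    by (simp add: bajraktarevic_mean_def fun_eq_iff)
  have "symmetric_on D (bajraktarevic_mean D f)" "eliminative_on D (bajraktarevic_mean D f)"
    "reductive_on D (bajraktarevic_mean D f)"
    unfolding mean
    by (fact symmetric_on_weighted_sum eliminative_on_weighted_sum reductive_on_weighted_sum)+
  then show "decision_making_function D (bajraktarevic_mean D f)"
    unfolding decision_making_function_def
    using mean_effort_polar(1)[OF assms] mean_effort_singleton(1)[OF assms]
      mean_effort_scale(1)[OF assms]
    by auto
  define g where "g y = ray_ratio y (f (radial_inverse D f y))" for y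
  have effort: "bajraktarevic_effort D f = (\<lambda>p. g (weighted_sum f p))"
    by (simp add: bajraktarevic_effort_def bajraktarevic_mean_def g_def fun_eq_iff)
  have "symmetric_on D (bajraktarevic_effort D f)" "eliminative_on D (bajraktarevic_effort D f)"
    "reductive_on D (bajraktarevic_effort D f)"
    unfolding effort
    by (fact symmetric_on_weighted_sum eliminative_on_weighted_sum reductive_on_weighted_sum)+
  then show "effort_function D (bajraktarevic_effort D f)"
    unfolding effort_function_def
    using mean_effort_polar(2)[OF assms] mean_effort_singleton(2)[OF assms]
      mean_effort_scale(2)[OF assms]
    by auto
qed

end
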